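(* Let $K,N,V\ge1$ be integers, let $\alpha=(\alpha_1,\dots,\alpha_K)$ with all $\alpha_k>0$, and write $\alpha=\overline{\alpha}\tilde\alpha$ with $\overline{\alpha}=\sum_{k=1}^K\alpha_k$ and $\tilde\alpha\in\Delta^{K-1}$. Let $\Theta=(\theta_1,\dots,\theta_K)\in(\Delta^{V-1})^K$. Then for every $x=(x_1,\dots,x_N)\in\{1,\dots,V\}^N$, $$p^{\mathscr{L}}_{\alpha,\Theta}(x) = \frac{1}{\overline{\alpha}^{[N]}}\left[\sum_{n=1}^{N}\overline{\alpha}^{\,n} \sum_{(S_1, \dots, S_n) \in \mathcal{P}(N, n)}\ \prod_{i=1}^{n} (|S_i|-1)!\; p^{\mathscr{M}}_{\tilde{\alpha}, \Theta}(x_{S_i})\right].$$ Conversely, $$p^{\mathscr{M}}_{\tilde{\alpha},\Theta}(x) = \frac{1}{(N-1)!\, \overline{\alpha}} \left[\sum_{n=1}^{N} (-1)^{n-1} (n-1)!\sum_{(S_1, \dots, S_n) \in \mathcal{P}(N, n)}\ \prod_{i=1}^{n} \overline{\alpha}^{[|S_i|]}\, p^{\mathscr{L}}_{\alpha, \Theta}(x_{S_i})\right].$$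
   Context: $\Delta^{D-1}$ is the set of probability vectors in $\mathbb{R}^D$. $a^{[n]}=a(a+1)\cdots(a+n-1)$ is the rising factorial, while $a^n$ is the usual power. $\mathcal{P}(N,n)$ is the set of all partitions of $\{1,\dots,N\}$ into $n$ disjoint non-empty subsets (unordered: each set partition is counted once). For documents of length $N$ over the vocabulary $\{1,\dots,V\}$, the Latent Dirichlet Allocation (LDA) probability mass function is $$p^{\mathscr{L}}_{\alpha,\Theta}(x_1,\dots,x_N)=\mathbb{E}_{q\sim\mathrm{Dir}_\alpha}\prod_{j=1}^N\Big(\sum_{k=1}^K q_k\theta_{k x_j}\Big),$$ and the mixture-of-products probability mass function is $$p^{\mathscr{M}}_{\tilde\alpha,\Theta}(x_1,\dots,x_N)=\sum_{k=1}^K\tilde\alpha_k\theta_{kx_1}\cdots\theta_{kx_N}.$$ For $S=\{s_1,\dots,s_r\}\subset\{1,\dots,N\}$, $p(x_S)=p(x_{s_1},\dots,x_{s_r})$ is the marginal of $p$ on the coordinates in $S$ (i.e. the same formula with only the words $x_s$, $s\in S$; both distributions are exchangeable). *)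

theory Defs
  imports "HOL-Probability.Probability" "HOL-Library.Disjoint_Sets"
begin

text \<open>
  Vectors in \<open>\<real>\<^sup>D\<close> are functions \<open>nat \<Rightarrow> real\<close> of which only the coordinates \<open>1, \<dots>, D\<close> matter;
  a document with positions \<open>I\<close> is likewise a function \<open>x\<close> considered on \<open>I\<close> only, so that
  the sub-document \<open>x\<^sub>S\<close> is obtained by replacing \<open>I\<close> by \<open>S\<close>.
\<close>

definition prob_simplex :: "nat \<Rightarrow> (nat \<Rightarrow> real) set" where
  "prob_simplex D = {p. (\<forall>i\<in>{1..D}. 0 \<le> p i) \<and> (\<Sum>i=1..D. p i) = 1}"

text \<open>
  The simplex is parametrised by its first \<open>K - 1\<close> coordinates. The Dirichlet distribution has
  the usual density with respect to Lebesgue measure in these coordinates; for \<open>K = 1\<close>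
  it is the point mass at the only probability vector.
\<close>

definition simplex_lift :: "nat \<Rightarrow> (nat \<Rightarrow> real) \<Rightarrow> nat \<Rightarrow> real" where
  "simplex_lift K q = q(K := 1 - (\<Sum>k=1..<K. q k))"

definition dirichlet_density :: "nat \<Rightarrow> (nat \<Rightarrow> real) \<Rightarrow> (nat \<Rightarrow> real) \<Rightarrow> real" where
  "dirichlet_density K \<alpha> q =
     (if \<forall>k\<in>{1..K}. 0 < q k
      then Gamma (\<Sum>k=1..K. \<alpha> k) / (\<Prod>k=1..K. Gamma (\<alpha> k)) * (\<Prod>k=1..K. q k powr (\<alpha> k - 1))
      else 0)"

definition dirichlet :: "nat \<Rightarrow> (nat \<Rightarrow> real) \<Rightarrow> (nat \<Rightarrow> real) measure" where
  "dirichlet K \<alpha> =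
     distr
       (density (Pi\<^sub>M {1..<K} (\<lambda>_. lborel)) (\<lambda>q. ennreal (dirichlet_density K \<alpha> (simplex_lift K q))))
       (Pi\<^sub>M {1..K} (\<lambda>_. borel))
       (simplex_lift K)"

definition lda_pmf ::
    "nat \<Rightarrow> (nat \<Rightarrow> real) \<Rightarrow> (nat \<Rightarrow> nat \<Rightarrow> real) \<Rightarrow> nat set \<Rightarrow> (nat \<Rightarrow> nat) \<Rightarrow> real" where
  "lda_pmf K \<alpha> \<Theta> I x = (\<integral>q. (\<Prod>j\<in>I. \<Sum>k=1..K. q k * \<Theta> k (x j)) \<partial>dirichlet K \<alpha>)"

definition mixture_pmf ::
    "nat \<Rightarrow> (nat \<Rightarrow> real) \<Rightarrow> (nat \<Rightarrow> nat \<Rightarrow> real) \<Rightarrow> nat set \<Rightarrow> (nat \<Rightarrow> nat) \<Rightarrow> real" where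
  "mixture_pmf K a \<Theta> I x = (\<Sum>k=1..K. a k * (\<Prod>j\<in>I. \<Theta> k (x j)))"

definition set_partitions :: "nat \<Rightarrow> nat \<Rightarrow> nat set set set" where
  "set_partitions N n = {P. partition_on {1..N} P \<and> card P = n}"

end

theory Submission imports Defs begin

text \<open>
  Replace the words by arbitrary functions \<open>f j\<close> of the topic, \<open>f j k = \<Theta> k (x j)\<close> being the case
  of interest, and scale both probabilities: let \<open>L I f\<close> be \<open>A\<^bsup>[|I|]\<^esup> \<Prod>\<^sub>j \<Sum>\<^sub>k q\<^sub>k f\<^sub>j(k)\<close> averaged over
  a Dirichlet vector \<open>q\<close>, and \<open>M I f = (|I| - 1)! \<Sum>\<^sub>k \<alpha>\<^sub>k \<Prod>\<^sub>j f\<^sub>j(k)\<close>. The two claims say that \<open>L\<close> is the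
  sum over partitions of the products of \<open>M\<close> over blocks, and that \<open>M\<close> is the signed sum over
  partitions of the products of \<open>L\<close> over blocks, as for moments and cumulants.

  Both follow from one recurrence for adding a word \<open>i\<close> to \<open>I\<close>. Let \<open>f[i,j]\<close> be \<open>f\<close> with \<open>f j\<close>
  replaced by the pointwise product of \<open>f j\<close> and \<open>f i\<close>. Then, with \<open>\<mu> g = \<Sum>\<^sub>k \<alpha>\<^sub>k g(k)\<close>,

    \<open>L (I \<union> {i}) f = \<mu> (f i) L I f + \<Sum>\<^sub>j L I f[i,j]\<close>  and  \<open>M (I \<union> {i}) f = \<Sum>\<^sub>j M I f[i,j]\<close>,

  the second one for nonempty \<open>I\<close> (\<open>urn_sum_insert\<close>, \<open>block_mass_insert\<close>). The first one is the
  Polya urn: the moments of the Dirichlet distribution make the topic of word \<open>i\<close> either a fresh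
  draw with weights \<open>\<alpha>\<close> or a copy of the topic of an earlier word \<open>j\<close>, and copying a topic amounts to
  multiplying the two factors. On the other side, \<open>i\<close> enters a partition of \<open>I\<close> as a new block or
  by joining a block \<open>B\<close>. If a set function \<open>F\<close> satisfies a recurrence of the above form, the sum over
  \<open>j \<in> B\<close> over all blocks \<open>B\<close> is the sum over \<open>j \<in> I\<close>, and so the partition sum built from \<open>F\<close> satisfies
  one too (\<open>partition_sum_insert\<close>). For \<open>F = M\<close> it is the recurrence of \<open>L\<close>. For \<open>F = L\<close> and weight
  \<open>(-1)\<^bsup>n-1\<^esup> (n-1)!\<close> on \<open>n\<close> blocks, the \<open>\<mu> (f i)\<close> terms cancel, the new block contributing
  \<open>(-1)\<^sup>n n!\<close> and the \<open>n\<close> old ones \<open>n (-1)\<^bsup>n-1\<^esup> (n-1)!\<close>; what remains is the recurrence of \<open>M\<close>.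
  Induction on \<open>I\<close>, for all \<open>f\<close> at once, finishes both proofs.

  The link to the probability density is the moment formula
  \<open>E \<Prod>\<^sub>k q\<^sub>k\<^bsup>n(k)\<^esup> = \<Prod>\<^sub>k \<alpha>\<^sub>k\<^bsup>[n(k)]\<^esup> / A\<^bsup>[n(1) + \<dots> + n(K)]\<^esup>\<close> (\<open>dirichlet_monomial_moment\<close>), which reduces to
  Dirichlet's integral over the simplex.
\<close>

section \<open>Set partitions of a set with one more element\<close>

definition partitions :: "'a set \<Rightarrow> 'a set set set" where
  "partitions I = {P. partition_on I P}"

text \<open>
  The new element forms a block of its own or joins one of the existing blocks, and the partition
  together with this choice can be read off the result.
\<close>

lemma sum_partitions_insert:
  fixes g :: "'a set set \<Rightarrow> 'b::comm_monoid_add"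
  assumes fin: "finite I" and i: "i \<notin> I"
  shows "(\<Sum>P\<in>partitions (insert i I). g P) =
         (\<Sum>P\<in>partitions I. g (insert {i} P) + (\<Sum>B\<in>P. g (insert (insert i B) (P - {B}))))"
proof -
  let ?new = "\<lambda>P. insert {i} P"
  let ?ext = "\<lambda>(P, B). insert (insert i B) (P - {B})"
  let ?S = "Sigma (partitions I) (\<lambda>P. P)"
  have fin_parts: "finite (partitions I)"
    unfolding partitions_def by (rule finitely_many_partition_on[OF fin])
  have fin_P: "finite P" if "P \<in> partitions I" for P
    using that finite_elements[OF fin] by (auto simp: partitions_def)
  have notin: "i \<notin> B" if "P \<in> partitions I" "B \<in> P" for P B
    using that i by (auto simp: partitions_def partition_on_def)
  have inj_new: "inj_on ?new (partitions I)"
  proof (rule inj_onI)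
    fix P Q assume PQ: "P \<in> partitions I" "Q \<in> partitions I" "insert {i} P = insert {i} Q"
    have "{i} \<notin> P" "{i} \<notin> Q" using notin[OF PQ(1), of "{i}"] notin[OF PQ(2), of "{i}"] by auto
    then show "P = Q" using PQ(3) insert_ident[of "{i}" P Q] by simp
  qed
  have inj_ext: "inj_on ?ext ?S"
  proof (rule inj_onI, clarify)
    fix P B Q C
    assume P: "P \<in> partitions I" "B \<in> P" and Q: "Q \<in> partitions I" "C \<in> Q"
      and eq: "insert (insert i B) (P - {B}) = insert (insert i C) (Q - {C})"
    have iB: "i \<notin> B" "insert i B \<notin> P - {B}" and iC: "i \<notin> C" "insert i C \<notin> Q - {C}"
      using notin[OF P(1)] notin[OF Q(1)] P(2) Q(2) by blast+
    have "insert i B \<in> insert (insert i C) (Q - {C})" using eq by blast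
    then have "insert i B = insert i C" using notin[OF Q(1)] by blast
    then have BC: "B = C" using insert_ident[OF iB(1) iC(1)] by simp
    then have "P - {B} = Q - {C}" using eq insert_ident[OF iB(2), of "Q - {C}"] iC(2) by simp
    then show "P = Q \<and> B = C" using BC P(2) Q(2) by (metis insert_Diff)
  qed
  have disj: "?new ` partitions I \<inter> ?ext ` ?S = {}"
  proof -
    have False if P: "P \<in> partitions I" and Q: "Q \<in> partitions I" "B \<in> Q"
      and eq: "insert {i} P = insert (insert i B) (Q - {B})" for P Q B
    proof -
      have "insert i B = {i}" using eq notin[OF P] by blast
      then have "B = {}" using notin[OF Q] by blast
      then show False using Q by (auto simp: partitions_def partition_on_def)
    qed
    then show ?thesis by auto
  qed
  have split: "partitions (insert i I) = ?new ` partitions I \<union> ?ext ` ?S"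
  proof (intro equalityI subsetI)
    fix R assume "R \<in> partitions (insert i I)"
    then have R: "partition_on (insert i I) R" by (simp add: partitions_def)
    then obtain C where C: "C \<in> R" "i \<in> C" by (auto simp: partition_on_def)
    have dis: "disjnt C (\<Union>(R - {C}))"
      using R C unfolding partition_on_def disjoint_def disjnt_def by blast
    have RC: "insert C (R - {C}) = R" using C by blast
    have rest: "partition_on (insert i I - C) (R - {C})" and CI: "C \<subseteq> insert i I"
      using partition_on_insert[OF dis, of "insert i I"] R RC by auto
    show "R \<in> ?new ` partitions I \<union> ?ext ` ?S"
    proof (cases "C = {i}")
      case True
      then have "R - {C} \<in> partitions I" using rest i by (simp add: partitions_def)
      then have "?new (R - {C}) \<in> ?new ` partitions I" by (rule imageI)
      then show ?thesis using RC True by simp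
    next
      case False
      let ?B = "C - {i}"
      have dis': "disjnt ?B (\<Union>(R - {C}))" using dis by (auto simp: disjnt_def)
      have "I - ?B = insert i I - C" using C i by auto
      then have "partition_on I (insert ?B (R - {C}))"
        using partition_on_insert[OF dis', of I] rest CI False C(2) by auto
      moreover have "?B \<notin> R - {C}"
        using dis' False C(2) by (auto simp: disjnt_def)
      then have "?ext (insert ?B (R - {C}), ?B) = R"
        using C(2) RC by (simp add: insert_absorb)
      ultimately show ?thesis by (intro UnI2 image_eqI[where x = "(insert ?B (R - {C}), ?B)"])
          (auto simp: partitions_def)
    qed
  next
    fix R assume "R \<in> ?new ` partitions I \<union> ?ext ` ?S"
    then consider P where "P \<in> partitions I" "R = insert {i} P"
      | P B where "P \<in> partitions I" "B \<in> P" "R = insert (insert i B) (P - {B})" by auto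
    then show "R \<in> partitions (insert i I)"
    proof cases
      case 1
      then have "disjnt {i} (\<Union>P)" using notin by (auto simp: disjnt_def)
      then show ?thesis using 1 i partition_on_insert[of "{i}" P "insert i I"]
        by (auto simp: partitions_def)
    next
      case 2
      then have P: "partition_on I P" by (simp add: partitions_def)
      have d0: "disjnt B (\<Union>(P - {B}))"
        using P 2 unfolding partition_on_def disjoint_def disjnt_def by blast
      then have d: "disjnt (insert i B) (\<Union>(P - {B}))"
        using notin[OF 2(1)] by (auto simp: disjnt_def)
      have "insert B (P - {B}) = P" using 2 by blast
      then have "partition_on (I - B) (P - {B})" "B \<subseteq> I"
        using partition_on_insert[OF d0, of I] P by auto
      moreover have "insert i I - insert i B = I - B" using i by auto
      ultimately show ?thesis using partition_on_insert[OF d, of "insert i I"] 2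
        by (auto simp: partitions_def)
    qed
  qed
  have "(\<Sum>P\<in>partitions (insert i I). g P) =
        (\<Sum>P\<in>partitions I. g (insert {i} P)) + (\<Sum>(P, B)\<in>?S. g (insert (insert i B) (P - {B})))"
  proof -
    have "finite ?S" using fin_parts fin_P by (rule finite_SigmaI)
    then have "(\<Sum>P\<in>partitions (insert i I). g P) = sum g (?new ` partitions I) + sum g (?ext ` ?S)"
      unfolding split using fin_parts disj by (intro sum.union_disjoint finite_imageI)
    then show ?thesis
      unfolding sum.reindex[OF inj_new] sum.reindex[OF inj_ext] by (simp add: case_prod_unfold)
  qed
  also have "(\<Sum>(P, B)\<in>?S. g (insert (insert i B) (P - {B}))) =
             (\<Sum>P\<in>partitions I. \<Sum>B\<in>P. g (insert (insert i B) (P - {B})))"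
    using fin_parts fin_P by (subst sum.Sigma) auto
  finally show ?thesis by (simp add: sum.distrib)
qed

section \<open>The Polya urn sum\<close>

definition topic_sum :: "'k set \<Rightarrow> ('k \<Rightarrow> real) \<Rightarrow> ('k \<Rightarrow> real) \<Rightarrow> real" where
  "topic_sum T \<alpha> g = (\<Sum>k\<in>T. \<alpha> k * g k)"

text \<open>
  Word \<open>i\<close> is absorbed by word \<open>j\<close>: whenever both have the same topic, their joint factor is carried
  by position \<open>j\<close> alone.
\<close>

definition merge_words :: "'a \<Rightarrow> 'a \<Rightarrow> ('a \<Rightarrow> 'k \<Rightarrow> real) \<Rightarrow> 'a \<Rightarrow> 'k \<Rightarrow> real" where
  "merge_words i j f = f(j := \<lambda>k. f j k * f i k)"

text \<open>
  Up to the factor \<open>A\<^bsup>[|I|]\<^esup>\<close>, this is the probability that the words in \<open>I\<close> get the topics \<open>z\<close>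
  when topics are drawn independently from a Dirichlet vector.
\<close>

definition urn_weight :: "'k set \<Rightarrow> ('k \<Rightarrow> real) \<Rightarrow> 'a set \<Rightarrow> ('a \<Rightarrow> 'k) \<Rightarrow> real" where
  "urn_weight T \<alpha> I z = (\<Prod>k\<in>T. pochhammer (\<alpha> k) (card {j \<in> I. z j = k}))"

definition urn_sum :: "'k set \<Rightarrow> ('k \<Rightarrow> real) \<Rightarrow> 'a set \<Rightarrow> ('a \<Rightarrow> 'k \<Rightarrow> real) \<Rightarrow> real" where
  "urn_sum T \<alpha> I f = (\<Sum>z\<in>I \<rightarrow>\<^sub>E T. urn_weight T \<alpha> I z * (\<Prod>j\<in>I. f j (z j)))"

lemma urn_sum_empty [simp]: "urn_sum T \<alpha> {} f = 1"
  by (simp add: urn_sum_def urn_weight_def)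

text \<open>
  The last factor is the parameter \<open>\<alpha> c\<close> plus the number of words that have topic \<open>c\<close> already,
  the reinforcement of a Polya urn; it is the last factor of the rising factorial of \<open>\<alpha> c\<close>.
  Counting by a sum over words is what lets each word be merged with later on.
\<close>

lemma urn_weight_insert:
  assumes "finite T" "finite I" "i \<notin> I" "c \<in> T"
  shows "urn_weight T \<alpha> (insert i I) (z(i := c)) =
         urn_weight T \<alpha> I z * (\<alpha> c + (\<Sum>j\<in>I. if z j = c then 1 else 0))"
proof -
  have at_c: "{j \<in> insert i I. (z(i := c)) j = c} = insert i {j \<in> I. z j = c}"
    using assms by auto
  have off_c: "{j \<in> insert i I. (z(i := c)) j = k} = {j \<in> I. z j = k}" if "k \<noteq> c" for k
    using assms that by auto
  have rest: "(\<Prod>k\<in>T - {c}. pochhammer (\<alpha> k) (card {j \<in> insert i I. (z(i := c)) j = k})) =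
      (\<Prod>k\<in>T - {c}. pochhammer (\<alpha> k) (card {j \<in> I. z j = k}))"
    by (intro prod.cong refl) (metis DiffD2 insertI1 off_c)
  have "card (insert i {j \<in> I. z j = c}) = Suc (card {j \<in> I. z j = c})"
    using assms by simp
  then have "urn_weight T \<alpha> (insert i I) (z(i := c)) =
        pochhammer (\<alpha> c) (Suc (card {j \<in> I. z j = c})) *
        (\<Prod>k\<in>T - {c}. pochhammer (\<alpha> k) (card {j \<in> I. z j = k}))"
    unfolding urn_weight_def prod.remove[OF assms(1,4)] at_c rest by simp
  also have "\<dots> = urn_weight T \<alpha> I z * (\<alpha> c + real (card {j \<in> I. z j = c}))"
    unfolding urn_weight_def prod.remove[OF assms(1,4)] by (simp add: pochhammer_Suc mult_ac)
  also have "real (card {j \<in> I. z j = c}) = (\<Sum>j\<in>I. if z j = c then 1 else 0)"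
    using assms by (simp add: sum.If_cases Int_def)
  finally show ?thesis .
qed

lemma prod_merge_words:
  assumes "finite I" "j \<in> I"
  shows "(\<Prod>l\<in>I. merge_words i j f l (z l)) = (\<Prod>l\<in>I. f l (z l)) * f i (z j)"
proof -
  have "(\<Prod>l\<in>I. merge_words i j f l (z l)) = f j (z j) * f i (z j) * (\<Prod>l\<in>I - {j}. f l (z l))"
    unfolding prod.remove[OF assms] by (auto simp: merge_words_def intro!: prod.cong)
  then show ?thesis unfolding prod.remove[OF assms] by (simp add: mult_ac)
qed

text \<open>
  Splitting the reinforced weight \<open>\<alpha> c + |{j. z j = c}|\<close> of the new word's topic gives the two terms:
  the first part sums over \<open>c\<close> freely, the second one forces the topic of \<open>i\<close> to equal that of
  some \<open>j\<close>.
\<close>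

lemma urn_sum_insert:
  assumes T: "finite T" and I: "finite I" "i \<notin> I"
  shows "urn_sum T \<alpha> (insert i I) f =
         topic_sum T \<alpha> (f i) * urn_sum T \<alpha> I f + (\<Sum>j\<in>I. urn_sum T \<alpha> I (merge_words i j f))"
proof -
  let ?w = "\<lambda>z. urn_weight T \<alpha> I z * (\<Prod>j\<in>I. f j (z j))"
  have prod_i: "(\<Prod>j\<in>insert i I. f j ((z(i := c)) j)) = f i c * (\<Prod>j\<in>I. f j (z j))" for z c
    using I by (auto intro!: prod.cong)
  have "urn_sum T \<alpha> (insert i I) f =
        (\<Sum>(c, z)\<in>T \<times> (I \<rightarrow>\<^sub>E T). ?w z * f i c * (\<alpha> c + (\<Sum>j\<in>I. if z j = c then 1 else 0)))"
    unfolding urn_sum_def PiE_insert_eq sum.reindex[OF inj_combinator[OF I(2), of "\<lambda>_. T"]]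
    by (intro sum.cong refl) (clarsimp simp only: o_apply case_prod_conv mem_Sigma_iff
        urn_weight_insert[OF T I] prod_i mult_ac)
  also have "\<dots> = (\<Sum>z\<in>I \<rightarrow>\<^sub>E T. \<Sum>c\<in>T. ?w z * f i c * (\<alpha> c + (\<Sum>j\<in>I. if z j = c then 1 else 0)))"
    unfolding sum.cartesian_product[symmetric] by (rule sum.swap)
  also have "\<dots> = (\<Sum>z\<in>I \<rightarrow>\<^sub>E T. ?w z * topic_sum T \<alpha> (f i) + (\<Sum>j\<in>I. ?w z * f i (z j)))"
  proof (rule sum.cong[OF refl])
    fix z assume z: "z \<in> I \<rightarrow>\<^sub>E T"
    have "(\<Sum>c\<in>T. f i c * (\<Sum>j\<in>I. if z j = c then 1 else 0)) =
          (\<Sum>j\<in>I. \<Sum>c\<in>T. f i c * (if z j = c then 1 else 0))"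
      unfolding sum_distrib_left by (rule sum.swap)
    also have "\<dots> = (\<Sum>j\<in>I. f i (z j))"
    proof (rule sum.cong[OF refl])
      fix j assume "j \<in> I"
      then have "z j \<in> T" using z by auto
      then show "(\<Sum>c\<in>T. f i c * (if z j = c then 1 else 0)) = f i (z j)"
        using T by (simp add: if_distrib sum.delta cong: if_cong)
    qed
    finally have *: "(\<Sum>c\<in>T. f i c * (\<Sum>j\<in>I. if z j = c then 1 else 0)) = (\<Sum>j\<in>I. f i (z j))" .
    have "(\<Sum>c\<in>T. ?w z * f i c * (\<alpha> c + (\<Sum>j\<in>I. if z j = c then 1 else 0))) =
          ?w z * ((\<Sum>c\<in>T. \<alpha> c * f i c) + (\<Sum>c\<in>T. f i c * (\<Sum>j\<in>I. if z j = c then 1 else 0)))"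
      unfolding sum.distrib[symmetric] sum_distrib_left[of "?w z"]
      by (rule sum.cong) (auto simp: algebra_simps)
    then show "(\<Sum>c\<in>T. ?w z * f i c * (\<alpha> c + (\<Sum>j\<in>I. if z j = c then 1 else 0))) =
               ?w z * topic_sum T \<alpha> (f i) + (\<Sum>j\<in>I. ?w z * f i (z j))"
      unfolding * by (simp add: topic_sum_def distrib_left sum_distrib_left)
  qed
  also have "\<dots> = topic_sum T \<alpha> (f i) * urn_sum T \<alpha> I f + (\<Sum>j\<in>I. \<Sum>z\<in>I \<rightarrow>\<^sub>E T. ?w z * f i (z j))"
    unfolding sum.distrib urn_sum_def sum_distrib_left
    by (subst sum.swap[of _ I]) (simp add: mult_ac)
  also have "(\<Sum>j\<in>I. \<Sum>z\<in>I \<rightarrow>\<^sub>E T. ?w z * f i (z j)) = (\<Sum>j\<in>I. urn_sum T \<alpha> I (merge_words i j f))"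
    unfolding urn_sum_def using I by (intro sum.cong refl) (simp add: prod_merge_words mult_ac)
  finally show ?thesis .
qed

lemma urn_sum_singleton: "finite T \<Longrightarrow> urn_sum T \<alpha> {i} f = topic_sum T \<alpha> (f i)"
  using urn_sum_insert[of T "{}" i \<alpha> f] by simp

section \<open>Sums over set partitions\<close>

definition block_mass :: "'k set \<Rightarrow> ('k \<Rightarrow> real) \<Rightarrow> 'a set \<Rightarrow> ('a \<Rightarrow> 'k \<Rightarrow> real) \<Rightarrow> real" where
  "block_mass T \<alpha> S f = fact (card S - 1) * topic_sum T \<alpha> (\<lambda>k. \<Prod>j\<in>S. f j k)"

lemma block_mass_singleton [simp]: "block_mass T \<alpha> {i} f = topic_sum T \<alpha> (f i)"
  by (simp add: block_mass_def)

text \<open>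
  All \<open>|S|\<close> summands are equal, since merging \<open>i\<close> into any \<open>j\<close> leaves the same product of factors;
  the factorials then match by \<open>|S| (|S| - 1)! = |S|!\<close>.
\<close>

lemma block_mass_insert:
  assumes "finite S" "S \<noteq> {}" "i \<notin> S"
  shows "block_mass T \<alpha> (insert i S) f = (\<Sum>j\<in>S. block_mass T \<alpha> S (merge_words i j f))"
proof -
  have "block_mass T \<alpha> S (merge_words i j f) =
        fact (card S - 1) * topic_sum T \<alpha> (\<lambda>k. \<Prod>j\<in>insert i S. f j k)" if "j \<in> S" for j
    unfolding block_mass_def using assms that prod_merge_words[of S j i f "\<lambda>_. k" for k]
    by (simp add: mult_ac)
  then have "(\<Sum>j\<in>S. block_mass T \<alpha> S (merge_words i j f)) =
        (card S * fact (card S - 1)) * topic_sum T \<alpha> (\<lambda>k. \<Prod>j\<in>insert i S. f j k)" by simp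
  also have "card S * fact (card S - 1) = (fact (card S) :: real)"
    using assms by (simp add: fact_reduce card_gt_0_iff)
  finally show ?thesis using assms by (simp add: block_mass_def)
qed

definition partition_sum ::
    "(nat \<Rightarrow> real) \<Rightarrow> ('a set \<Rightarrow> ('a \<Rightarrow> 'k \<Rightarrow> real) \<Rightarrow> real) \<Rightarrow> 'a set \<Rightarrow> ('a \<Rightarrow> 'k \<Rightarrow> real) \<Rightarrow> real" where
  "partition_sum w F I f = (\<Sum>P\<in>partitions I. w (card P) * (\<Prod>S\<in>P. F S f))"

text \<open>
  The recurrence of \<open>F\<close> passes to the partition sum because the element \<open>j\<close> absorbing \<open>i\<close> lies in exactly
  one block, which is the only factor that the merging changes; \<open>F_cong\<close> expresses that \<open>F S\<close>
  sees only the factors in \<open>S\<close>. The coefficient of the unmerged product collects the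
  new block and the term \<open>r\<close> of each of the \<open>card P\<close> blocks that may be joined.
\<close>

lemma partition_sum_insert:
  fixes F :: "'a set \<Rightarrow> ('a \<Rightarrow> 'k \<Rightarrow> real) \<Rightarrow> real"
    and w :: "nat \<Rightarrow> real" and r :: real
  assumes I: "finite I" "i \<notin> I"
    and F_cong: "\<And>S g h. (\<And>j. j \<in> S \<Longrightarrow> g j = h j) \<Longrightarrow> F S g = F S h"
    and F_insert: "\<And>S. finite S \<Longrightarrow> S \<noteq> {} \<Longrightarrow> i \<notin> S \<Longrightarrow>
      F (insert i S) f = r * F S f + (\<Sum>j\<in>S. F S (merge_words i j f))"
  shows "partition_sum w F (insert i I) f =
    (\<Sum>P\<in>partitions I. (w (Suc (card P)) * F {i} f + card P * w (card P) * r) * (\<Prod>S\<in>P. F S f))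
    + (\<Sum>j\<in>I. partition_sum w F I (merge_words i j f))"
proof -
  have summand: "w (card (insert {i} P)) * (\<Prod>S\<in>insert {i} P. F S f) +
      (\<Sum>B\<in>P. w (card (insert (insert i B) (P - {B}))) * (\<Prod>S\<in>insert (insert i B) (P - {B}). F S f)) =
      (w (Suc (card P)) * F {i} f + card P * w (card P) * r) * (\<Prod>S\<in>P. F S f) +
      (\<Sum>j\<in>I. w (card P) * (\<Prod>S\<in>P. F S (merge_words i j f)))" if "P \<in> partitions I" for P
  proof -
    have P: "partition_on I P" using that by (simp add: partitions_def)
    have finP: "finite P" using finite_elements[OF I(1) P] .
    have notin: "i \<notin> B" if "B \<in> P" for B using that P I by (auto simp: partition_on_def)
    have new: "w (card (insert {i} P)) * (\<Prod>S\<in>insert {i} P. F S f) =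
               w (Suc (card P)) * F {i} f * (\<Prod>S\<in>P. F S f)"
      using finP notin[of "{i}"] by (subst card_insert_disjoint, blast, blast) (subst prod.insert, auto)
    have ext: "w (card (insert (insert i B) (P - {B}))) * (\<Prod>S\<in>insert (insert i B) (P - {B}). F S f) =
        w (card P) * r * (\<Prod>S\<in>P. F S f) + (\<Sum>j\<in>B. w (card P) * (\<Prod>S\<in>P. F S (merge_words i j f)))"
      if B: "B \<in> P" for B
    proof -
      have fresh: "insert i B \<notin> P - {B}" using notin by blast
      have c: "card (insert (insert i B) (P - {B})) = card P"
        using fresh finP B by (simp add: card_Suc_Diff1 del: card_Diff_insert)
      have "B \<subseteq> I" "B \<noteq> {}" using P B by (auto simp: partition_on_def)
      then have FB: "F (insert i B) f = r * F B f + (\<Sum>j\<in>B. F B (merge_words i j f))"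
        using F_insert[of B] finite_subset[OF _ I(1)] notin[OF B] by blast
      have merged: "(\<Prod>S\<in>P. F S (merge_words i j f)) = F B (merge_words i j f) * (\<Prod>S\<in>P - {B}. F S f)"
        if j: "j \<in> B" for j
      proof -
        have "F S (merge_words i j f) = F S f" if "S \<in> P - {B}" for S
          using P B that j by (intro F_cong) (auto simp: merge_words_def partition_on_def disjoint_def)
        then have "(\<Prod>S\<in>P - {B}. F S (merge_words i j f)) = (\<Prod>S\<in>P - {B}. F S f)"
          by (rule prod.cong[OF refl])
        then show ?thesis using prod.remove[OF finP B, of "\<lambda>S. F S (merge_words i j f)"] by simp
      qed
      have "(\<Prod>S\<in>insert (insert i B) (P - {B}). F S f) = F (insert i B) f * (\<Prod>S\<in>P - {B}. F S f)"
        using fresh finP by (simp add: prod.insert)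
      also have "\<dots> = r * (\<Prod>S\<in>P. F S f) + (\<Sum>j\<in>B. \<Prod>S\<in>P. F S (merge_words i j f))"
        unfolding FB using merged prod.remove[OF finP B, of "\<lambda>S. F S f"]
        by (simp add: algebra_simps sum_distrib_right)
      finally show ?thesis unfolding c by (simp add: algebra_simps sum_distrib_left)
    qed
    have finB: "\<forall>B\<in>P. finite B"
      using partition_onD1[OF P] finite_subset[OF _ I(1)] by auto
    have dis: "\<forall>B\<in>P. \<forall>C\<in>P. B \<noteq> C \<longrightarrow> B \<inter> C = {}" using P by (auto simp: partition_on_def disjoint_def)
    have over_I: "(\<Sum>B\<in>P. \<Sum>j\<in>B. h j) = (\<Sum>j\<in>I. h j)" for h :: "'a \<Rightarrow> real"
      using sum.Union_disjoint[OF finB dis, of h] partition_onD1[OF P] by simp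
    have "(\<Sum>B\<in>P. w (card (insert (insert i B) (P - {B}))) * (\<Prod>S\<in>insert (insert i B) (P - {B}). F S f)) =
        (\<Sum>B\<in>P. w (card P) * r * (\<Prod>S\<in>P. F S f) + (\<Sum>j\<in>B. w (card P) * (\<Prod>S\<in>P. F S (merge_words i j f))))"
      by (intro sum.cong refl ext)
    also have "\<dots> = card P * (w (card P) * r * (\<Prod>S\<in>P. F S f)) +
        (\<Sum>j\<in>I. w (card P) * (\<Prod>S\<in>P. F S (merge_words i j f)))"
      unfolding sum.distrib over_I by simp
    finally show ?thesis unfolding new distrib_right by (simp only: mult_ac add_ac)
  qed
  have "partition_sum w F (insert i I) f = (\<Sum>P\<in>partitions I.
      (w (Suc (card P)) * F {i} f + card P * w (card P) * r) * (\<Prod>S\<in>P. F S f) +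
      (\<Sum>j\<in>I. w (card P) * (\<Prod>S\<in>P. F S (merge_words i j f))))"
    unfolding partition_sum_def sum_partitions_insert[OF I] by (intro sum.cong refl summand)
  also have "\<dots> = (\<Sum>P\<in>partitions I.
      (w (Suc (card P)) * F {i} f + card P * w (card P) * r) * (\<Prod>S\<in>P. F S f))
      + (\<Sum>j\<in>I. partition_sum w F I (merge_words i j f))"
    unfolding sum.distrib partition_sum_def by (subst sum.swap[of _ I]) simp
  finally show ?thesis .
qed

lemma partitions_empty [simp]: "partitions {} = {{}}"
  by (auto simp: partitions_def partition_on_empty)

lemma partition_sum_singleton: "partition_sum w F {i} f = w 1 * F {i} f"
proof -
  have "partition_sum w F {i} f = (\<Sum>P\<in>partitions {}. w (card (insert {i} P)) * (\<Prod>S\<in>insert {i} P. F S f) +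
      (\<Sum>B\<in>P. w (card (insert (insert i B) (P - {B}))) * (\<Prod>S\<in>insert (insert i B) (P - {B}). F S f)))"
    unfolding partition_sum_def by (rule sum_partitions_insert) auto
  then show ?thesis by simp
qed

lemma block_mass_cong:
  "(\<And>j. j \<in> S \<Longrightarrow> g j = h j) \<Longrightarrow> block_mass T \<alpha> S g = block_mass T \<alpha> S h"
  by (simp add: block_mass_def cong: prod.cong)

lemma urn_sum_cong:
  "(\<And>j. j \<in> S \<Longrightarrow> g j = h j) \<Longrightarrow> urn_sum T \<alpha> S g = urn_sum T \<alpha> S h"
  by (simp add: urn_sum_def cong: prod.cong)

text \<open>
  Here \<open>r = 0\<close>: a block mass only has merging terms, and a fresh topic arises only from a new block.
\<close>

theorem urn_sum_eq_partition_sum: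
  assumes "finite T" "finite I"
  shows "urn_sum T \<alpha> I f = partition_sum (\<lambda>_. 1) (block_mass T \<alpha>) I f"
  using assms(2)
proof (induction I arbitrary: f rule: finite_induct)
  case empty
  show ?case by (simp add: partition_sum_def)
next
  case (insert i I)
  have "partition_sum (\<lambda>_. 1) (block_mass T \<alpha>) (insert i I) f =
        topic_sum T \<alpha> (f i) * partition_sum (\<lambda>_. 1) (block_mass T \<alpha>) I f +
        (\<Sum>j\<in>I. partition_sum (\<lambda>_. 1) (block_mass T \<alpha>) I (merge_words i j f))"
    using insert.hyps block_mass_insert[of _ i T \<alpha> f]
    by (subst partition_sum_insert[where r = 0])
       (auto intro: block_mass_cong simp: partition_sum_def sum_distrib_left)
  then show ?case using urn_sum_insert[OF assms(1) insert.hyps] insert.IH by simp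
qed

text \<open>
  Now \<open>r = \<mu> (f i)\<close> is the value of the new block as well, so that the unmerged products have
  coefficient \<open>\<mu> (f i) (w (n + 1) + n w n)\<close> with \<open>w n = (-1)\<^bsup>n-1\<^esup> (n-1)!\<close>, which vanishes for \<open>n \<ge> 1\<close>.
\<close>

theorem block_mass_eq_partition_sum:
  assumes "finite T" "finite I" "I \<noteq> {}"
  shows "block_mass T \<alpha> I f =
         partition_sum (\<lambda>n. (-1) ^ (n - 1) * fact (n - 1)) (urn_sum T \<alpha>) I f"
  using assms(2,3)
proof (induction I arbitrary: f rule: finite_induct)
  case empty
  then show ?case by simp
next
  case (insert i I)
  show ?case
  proof (cases "I = {}")
    case True
    then show ?thesis by (simp add: partition_sum_singleton urn_sum_singleton[OF assms(1)])
  next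
    case False
  let ?w = "\<lambda>n. (-1) ^ (n - 1) * fact (n - 1) :: real"
  have "(?w (Suc (card P)) * urn_sum T \<alpha> {i} f + card P * ?w (card P) * topic_sum T \<alpha> (f i)) = 0"
    if "P \<in> partitions I" for P
  proof -
    have "P \<noteq> {}" using that False by (auto simp: partitions_def partition_on_def)
    moreover have "finite P" using that finite_elements[OF insert.hyps(1)] by (auto simp: partitions_def)
    ultimately obtain m where "card P = Suc m" by (cases "card P") auto
    then show ?thesis
      by (simp add: urn_sum_singleton assms(1))
  qed
  then have "partition_sum ?w (urn_sum T \<alpha>) (insert i I) f =
             (\<Sum>j\<in>I. partition_sum ?w (urn_sum T \<alpha>) I (merge_words i j f))"
    using insert.hyps urn_sum_insert[OF assms(1), of _ i \<alpha> f]
    by (subst partition_sum_insert[where r = "topic_sum T \<alpha> (f i)"])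
       (auto intro: urn_sum_cong)
  then show ?thesis using insert False block_mass_insert[of I i T \<alpha> f] by simp
  qed
qed

section \<open>Moments of the Dirichlet distribution\<close>

text \<open>
  The cut-off at \<open>0\<close> makes the constraints that define the open simplex part of the factors, so that
  integrals over the simplex become integrals over the whole space.
\<close>

definition half_powr :: "real \<Rightarrow> real \<Rightarrow> real" where
  "half_powr a u = (if 0 < u then u powr (a - 1) else 0)"

lemma half_powr_nonneg [simp]: "0 \<le> half_powr a u"
  by (simp add: half_powr_def)

lemma measurable_half_powr [measurable]: "half_powr a \<in> borel_measurable borel"
  unfolding half_powr_def[abs_def] by measurable

lemma nn_integral_half_powr_Beta:
  assumes "0 < a" "0 < b"
  shows "(\<integral>\<^sup>+y. ennreal (half_powr a y * half_powr b (1 - y)) \<partial>lborel) = ennreal (Beta a b)"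
proof -
  have "(\<integral>\<^sup>+y. ennreal (half_powr a y * half_powr b (1 - y)) \<partial>lborel) =
        (\<integral>\<^sup>+y. ennreal (y powr (a - 1) * (1 - y) powr (b - 1)) * indicator {0..1} y \<partial>lborel)"
    by (intro nn_integral_cong) (auto simp: half_powr_def indicator_def)
  also have "\<dots> = ennreal (Beta a b)"
    by (rule nn_integral_has_integral_lebesgue'[OF _ has_integral_Beta_real[OF assms]]) auto
  finally show ?thesis .
qed

text \<open>
  Beta's integral on \<open>[0, s]\<close> after the substitution \<open>y = s u\<close>. In this form a coordinate of the simplex
  can be integrated out with the others held fixed.
\<close>

lemma nn_integral_half_powr_convolution:
  assumes "0 < a" "0 < b"
  shows "(\<integral>\<^sup>+y. ennreal (half_powr a y * half_powr b (s - y)) \<partial>lborel) =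
         ennreal (Beta a b * half_powr (a + b) s)"
proof (cases "0 < s")
  case True
  have Beta_nonneg: "0 \<le> Beta a b"
    using assms by (simp add: Beta_def Gamma_real_nonneg)
  have scale: "half_powr c (s * u) = s powr (c - 1) * half_powr c u" for c u
    using True by (auto simp: half_powr_def powr_mult zero_less_mult_iff)
  have "half_powr a (s * u) * half_powr b (s - s * u) =
        (s powr (a - 1) * s powr (b - 1)) * (half_powr a u * half_powr b (1 - u))" for u
    using scale[of a u] scale[of b "1 - u"] by (simp add: algebra_simps)
  then have "(\<integral>\<^sup>+y. ennreal (half_powr a y * half_powr b (s - y)) \<partial>lborel) =
        ennreal s * (\<integral>\<^sup>+u. ennreal (s powr (a - 1) * s powr (b - 1)) *
                            ennreal (half_powr a u * half_powr b (1 - u)) \<partial>lborel)"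
    using True by (subst nn_integral_real_affine[where c = s and t = 0]) (auto simp: ennreal_mult)
  also have "\<dots> = ennreal s * (ennreal (s powr (a - 1) * s powr (b - 1)) * ennreal (Beta a b))"
    using assms by (subst nn_integral_cmult) (auto simp: nn_integral_half_powr_Beta)
  also have "\<dots> = ennreal (s * (s powr (a - 1) * s powr (b - 1) * Beta a b))"
    using True Beta_nonneg by (simp add: ennreal_mult'' mult_nonneg_nonneg)
  also have "s * (s powr (a - 1) * s powr (b - 1) * Beta a b) = Beta a b * half_powr (a + b) s"
  proof -
    have "s * (s powr (a - 1) * s powr (b - 1)) = s powr (a + b - 1)"
      using True powr_add[of s 1 "a - 1 + (b - 1)"] powr_add[of s "a - 1" "b - 1"] 
      by (simp add: algebra_simps)
    then show ?thesis using True by (simp add: half_powr_def)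
  qed
  finally show ?thesis .
next
  case False
  then have "half_powr a y * half_powr b (s - y) = 0" for y
    by (auto simp: half_powr_def)
  then show ?thesis using False by (simp only: ennreal_0 nn_integral_const) (simp add: half_powr_def)
qed

text \<open>
  Integrating out \<open>q i\<close> merges it with the last coordinate \<open>1 - \<Sum>q\<close>, whose exponent parameter becomes
  \<open>a i + b\<close>; hence the induction is for all \<open>b\<close>. The Beta factors telescope into Gamma values.
\<close>

theorem dirichlet_integral:
  assumes "finite J" "\<And>k. k \<in> J \<Longrightarrow> 0 < a k" "0 < b"
  shows "(\<integral>\<^sup>+q. ennreal ((\<Prod>k\<in>J. half_powr (a k) (q k)) * half_powr b (1 - (\<Sum>k\<in>J. q k)))
            \<partial>Pi\<^sub>M J (\<lambda>_. lborel)) =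
         ennreal ((\<Prod>k\<in>J. Gamma (a k)) * Gamma b / Gamma ((\<Sum>k\<in>J. a k) + b))"
  using assms
proof (induction J arbitrary: b rule: finite_induct)
  case empty
  have "Gamma b \<noteq> 0" using Gamma_real_pos[of b] empty.prems by (metis less_irrefl)
  then show ?case by (simp add: PiM_empty half_powr_def)
next
  case (insert i J)
  interpret product_sigma_finite "\<lambda>_::'a. lborel :: real measure" by standard
  have pos: "0 < a i" "0 < b" "\<And>k. k \<in> J \<Longrightarrow> 0 < a k" using insert.prems by auto
  have "Gamma (a i + b) \<noteq> 0" using Gamma_real_pos[of "a i + b"] pos by (metis add_pos_pos less_irrefl)
  let ?p = "\<lambda>q. \<Prod>k\<in>J. half_powr (a k) (q k)"
  let ?s = "\<lambda>q. 1 - (\<Sum>k\<in>J. q k)"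
  have inner: "(\<integral>\<^sup>+y. ennreal ((\<Prod>k\<in>insert i J. half_powr (a k) ((q(i := y)) k)) *
                  half_powr b (1 - (\<Sum>k\<in>insert i J. (q(i := y)) k))) \<partial>lborel) =
               ennreal (Beta (a i) b) * ennreal (?p q * half_powr (a i + b) (?s q))" for q
  proof -
    have p: "(\<Prod>k\<in>J. half_powr (a k) ((q(i := y)) k)) = ?p q" for y
      using insert.hyps by (intro prod.cong) auto
    have s: "(\<Sum>k\<in>J. (q(i := y)) k) = (\<Sum>k\<in>J. q k)" for y
      using insert.hyps by (intro sum.cong) auto
    have "(\<integral>\<^sup>+y. ennreal ((\<Prod>k\<in>insert i J. half_powr (a k) ((q(i := y)) k)) *
                  half_powr b (1 - (\<Sum>k\<in>insert i J. (q(i := y)) k))) \<partial>lborel) =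
          (\<integral>\<^sup>+y. ennreal (?p q) * ennreal (half_powr (a i) y * half_powr b (?s q - y)) \<partial>lborel)"
      unfolding prod.insert[OF insert.hyps] sum.insert[OF insert.hyps] p s
      by (intro nn_integral_cong)
         (simp add: ennreal_mult[symmetric] prod_nonneg algebra_simps)
    also have "\<dots> = ennreal (?p q) * ennreal (Beta (a i) b * half_powr (a i + b) (?s q))"
      using pos by (subst nn_integral_cmult) (auto simp: nn_integral_half_powr_convolution)
    also have "\<dots> = ennreal (Beta (a i) b) * ennreal (?p q * half_powr (a i + b) (?s q))"
      using pos by (simp add: ennreal_mult[symmetric] prod_nonneg Beta_def Gamma_real_nonneg mult_ac)
    finally show ?thesis .
  qed
  have "(\<integral>\<^sup>+q. ennreal ((\<Prod>k\<in>insert i J. half_powr (a k) (q k)) *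
            half_powr b (1 - (\<Sum>k\<in>insert i J. q k))) \<partial>Pi\<^sub>M (insert i J) (\<lambda>_. lborel)) =
        (\<integral>\<^sup>+q. ennreal (Beta (a i) b) * ennreal (?p q * half_powr (a i + b) (?s q)) \<partial>Pi\<^sub>M J (\<lambda>_. lborel))"
    by (subst product_nn_integral_insert[OF insert.hyps]) (measurable, simp only: inner)
  also have "\<dots> = ennreal (Beta (a i) b) *
                  ennreal ((\<Prod>k\<in>J. Gamma (a k)) * Gamma (a i + b) / Gamma ((\<Sum>k\<in>J. a k) + (a i + b)))"
    using insert.IH[of "a i + b"] pos by (subst nn_integral_cmult) auto
  also have "\<dots> = ennreal (Beta (a i) b * ((\<Prod>k\<in>J. Gamma (a k)) * Gamma (a i + b) / Gamma ((\<Sum>k\<in>J. a k) + (a i + b))))"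
    using pos by (subst ennreal_mult') (auto simp: Beta_def Gamma_real_nonneg)
  also have "Beta (a i) b * ((\<Prod>k\<in>J. Gamma (a k)) * Gamma (a i + b) / Gamma ((\<Sum>k\<in>J. a k) + (a i + b))) =
             (\<Prod>k\<in>insert i J. Gamma (a k)) * Gamma b / Gamma ((\<Sum>k\<in>insert i J. a k) + b)"
    using insert.hyps \<open>Gamma (a i + b) \<noteq> 0\<close> by (simp add: Beta_def add_ac)
  finally show ?case .
qed

lemma insert_last_index: "1 \<le> K \<Longrightarrow> {1..K} = insert K {1..<K}" for K :: nat
  by auto

text \<open>
  A monomial times the density is, up to a constant, the density with parameters \<open>\<alpha> k + n k\<close>, so the
  moment is a quotient of two normalisation constants, and the Gamma quotients are rising factorials.
\<close>

lemma dirichlet_monomial_moment: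
  assumes K: "1 \<le> K" and pos: "\<And>k. k \<in> {1..K} \<Longrightarrow> 0 < \<alpha> k"
  shows "has_bochner_integral (dirichlet K \<alpha>) (\<lambda>q. \<Prod>k=1..K. q k ^ n k)
           ((\<Prod>k=1..K. pochhammer (\<alpha> k) (n k)) / pochhammer (\<Sum>k=1..K. \<alpha> k) (\<Sum>k=1..K. n k))"
proof -
  let ?A = "\<Sum>k=1..K. \<alpha> k" and ?N = "\<Sum>k=1..K. n k"
  let ?M = "Pi\<^sub>M {1..<K} (\<lambda>_. lborel) :: (nat \<Rightarrow> real) measure"
  \<comment> \<open>normalisation constant of the density, the shifted parameters, and the claimed moment\<close>
  define C where "C = Gamma ?A / (\<Prod>k=1..K. Gamma (\<alpha> k))"
  define a where "a k = \<alpha> k + real (n k)" for k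
  define m where "m = (\<Prod>k=1..K. pochhammer (\<alpha> k) (n k)) / pochhammer ?A ?N"
  have K_in: "K \<in> {1..K}" using K by simp
  have A_pos: "0 < ?A" using K pos by (intro sum_pos) auto
  have a_pos: "0 < a k" if "k \<in> {1..K}" for k using pos[OF that] by (simp add: a_def)
  have C_nonneg: "0 \<le> C"
    unfolding C_def using A_pos pos by (intro divide_nonneg_nonneg prod_nonneg Gamma_real_nonneg) (auto intro: Gamma_real_nonneg less_imp_le)
  have lift_less: "simplex_lift K q k = q k" if "k \<in> {1..<K}" for q k
    using that by (simp add: simplex_lift_def)
  have lift_K: "simplex_lift K q K = 1 - (\<Sum>k=1..<K. q k)" for q
    by (simp add: simplex_lift_def)
  have lift_prod: "(\<Prod>k=1..K. h k (simplex_lift K q k)) =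
      (\<Prod>k=1..<K. h k (q k)) * h K (1 - (\<Sum>k=1..<K. q k))" for h :: "nat \<Rightarrow> real \<Rightarrow> real" and q
    unfolding insert_last_index[OF K] by (simp add: lift_less lift_K mult.commute)
  have density: "dirichlet_density K \<alpha> q = C * (\<Prod>k=1..K. half_powr (\<alpha> k) (q k))" for q
  proof (cases "\<forall>k\<in>{1..K}. 0 < q k")
    case True
    then show ?thesis by (simp add: dirichlet_density_def C_def half_powr_def)
  next
    case False
    then have "(\<Prod>k=1..K. half_powr (\<alpha> k) (q k)) = 0"
      by (intro prod_zero) (auto simp: half_powr_def)
    then show ?thesis using False unfolding dirichlet_density_def by (simp only: if_False mult_zero_right)
  qed
  have tilt: "half_powr c u * u ^ l = half_powr (c + real l) u" for c u l
  proof (cases "0 < u")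
    case True
    then show ?thesis
      using powr_add[of u "c - 1" "real l"] by (simp add: half_powr_def powr_realpow algebra_simps)
  qed (simp add: half_powr_def)
  \<comment> \<open>the monomial shifts the parameters of the density without changing its shape\<close>
  have tilted: "dirichlet_density K \<alpha> q * (\<Prod>k=1..K. q k ^ n k) =
      C * (\<Prod>k=1..K. half_powr (a k) (q k))" for q
    unfolding density a_def by (simp add: tilt flip: prod.distrib)
  have lift_meas [measurable]: "simplex_lift K \<in> measurable ?M (Pi\<^sub>M {1..K} (\<lambda>_. borel))"
  proof (rule measurable_PiM_single')
    fix k assume k: "k \<in> {1..K}"
    show "(\<lambda>q. simplex_lift K q k) \<in> borel_measurable ?M"
    proof (cases "k = K")
      case True
      then show ?thesis unfolding lift_K True by measurable
    next
      case False
      then have k': "k \<in> {1..<K}" using k by auto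
      then show ?thesis unfolding lift_less[OF k'] by measurable
    qed
  next
    show "simplex_lift K \<in> space ?M \<rightarrow> (\<Pi>\<^sub>E k\<in>{1..K}. space borel)"
      using K by (auto simp: simplex_lift_def space_PiM PiE_def extensional_def)
  qed
  have mono_meas [measurable]: "(\<lambda>q. \<Prod>k=1..K. q k ^ n k) \<in> borel_measurable (Pi\<^sub>M {1..K} (\<lambda>_. borel :: real measure))"
    by measurable
  have dens_meas [measurable]: "(\<lambda>q. dirichlet_density K \<alpha> (simplex_lift K q)) \<in> borel_measurable ?M"
    unfolding density lift_prod[of "\<lambda>k. half_powr (\<alpha> k)"] by measurable
  have sum_a: "(\<Sum>k=1..<K. a k) + a K = ?A + real ?N"
    using insert_last_index[OF K] by (simp add: a_def sum.distrib add.commute)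
  have "(\<integral>\<^sup>+q. ennreal (C * (\<Prod>k=1..K. half_powr (a k) (simplex_lift K q k))) \<partial>?M) =
        ennreal C * (\<integral>\<^sup>+q. ennreal ((\<Prod>k=1..<K. half_powr (a k) (q k)) *
          half_powr (a K) (1 - (\<Sum>k=1..<K. q k))) \<partial>?M)"
    unfolding lift_prod[of "\<lambda>k. half_powr (a k)"] ennreal_mult'[OF C_nonneg]
    by (rule nn_integral_cmult) measurable
  also have "\<dots> = ennreal C * ennreal ((\<Prod>k=1..<K. Gamma (a k)) * Gamma (a K) / Gamma (?A + real ?N))"
    using dirichlet_integral[of "{1..<K}" a "a K"] a_pos K_in unfolding sum_a by simp
  also have "\<dots> = ennreal (C * ((\<Prod>k=1..K. Gamma (a k)) / Gamma (?A + real ?N)))"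
    unfolding ennreal_mult'[OF C_nonneg] insert_last_index[OF K] by (simp add: mult.commute)
  also have "C * ((\<Prod>k=1..K. Gamma (a k)) / Gamma (?A + real ?N)) = m"
  proof -
    have "pochhammer c l = Gamma (c + real l) / Gamma c" if "0 < c" for c :: real and l
      using that by (intro pochhammer_Gamma) (auto elim!: nonpos_Ints_cases)
    then show ?thesis using pos A_pos by (simp add: m_def C_def a_def prod_dividef)
  qed
  finally have nn: "(\<integral>\<^sup>+q. ennreal (C * (\<Prod>k=1..K. half_powr (a k) (simplex_lift K q k))) \<partial>?M) = ennreal m" .
  have "0 \<le> m"
    unfolding m_def using A_pos pos by (intro divide_nonneg_nonneg prod_nonneg pochhammer_nonneg ballI) auto
  moreover have "(\<lambda>q. C * (\<Prod>k=1..K. half_powr (a k) (simplex_lift K q k))) \<in> borel_measurable ?M"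
    unfolding lift_prod[of "\<lambda>k. half_powr (a k)"] by measurable
  moreover note nn
  ultimately have "has_bochner_integral ?M
      (\<lambda>q. C * (\<Prod>k=1..K. half_powr (a k) (simplex_lift K q k))) m"
    using C_nonneg
    by (intro has_bochner_integral_nn_integral) (auto intro!: mult_nonneg_nonneg prod_nonneg)
  then have "has_bochner_integral ?M
      (\<lambda>q. dirichlet_density K \<alpha> (simplex_lift K q) *\<^sub>R (\<Prod>k=1..K. simplex_lift K q k ^ n k)) m"
    using tilted by simp
  then show ?thesis
    unfolding dirichlet_def m_def[symmetric]
    by (intro has_bochner_integral_distr has_bochner_integral_density
          measurable_compose[OF lift_meas mono_meas] mono_meas dens_meas)
       (use lift_meas C_nonneg in \<open>auto simp: density measurable_def space_density intro!: AE_I2 mult_nonneg_nonneg prod_nonneg\<close>)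
qed

section \<open>The two probability mass functions\<close>

lemma dirichlet_assignment_moment:
  assumes K: "1 \<le> K" and pos: "\<And>k. k \<in> {1..K} \<Longrightarrow> 0 < \<alpha> k"
    and I: "finite I" and z: "z \<in> I \<rightarrow> {1..K}"
  shows "has_bochner_integral (dirichlet K \<alpha>) (\<lambda>q. \<Prod>j\<in>I. q (z j))
           (urn_weight {1..K} \<alpha> I z / pochhammer (\<Sum>k=1..K. \<alpha> k) (card I))"
proof -
  let ?n = "\<lambda>k. card {j \<in> I. z j = k}"
  have zI: "z ` I \<subseteq> {1..K}" using z by auto
  have "(\<Prod>j\<in>I. q (z j)) = (\<Prod>k=1..K. q k ^ ?n k)" for q :: "nat \<Rightarrow> real"
  proof -
    have "(\<Prod>j\<in>I. q (z j)) = (\<Prod>k=1..K. \<Prod>j\<in>{j \<in> I. z j = k}. q (z j))"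
      by (rule prod.group[OF I finite_atLeastAtMost zI, symmetric])
    then show ?thesis by simp
  qed
  moreover have "(\<Sum>k=1..K. ?n k) = card I"
    using sum.group[OF I finite_atLeastAtMost zI, of "\<lambda>_. 1 :: nat"] by simp
  ultimately show ?thesis
    using dirichlet_monomial_moment[OF K pos, where n = ?n] by (simp add: urn_weight_def)
qed

text \<open>
  Expanding the product of sums over topics writes the integrand as a sum over all assignments of topics
  to words, whose moments are the urn weights.
\<close>

lemma lda_pmf_eq_urn_sum:
  assumes K: "1 \<le> K" and pos: "\<And>k. k \<in> {1..K} \<Longrightarrow> 0 < \<alpha> k" and I: "finite I"
  shows "pochhammer (\<Sum>k=1..K. \<alpha> k) (card I) * lda_pmf K \<alpha> \<Theta> I x =
         urn_sum {1..K} \<alpha> I (\<lambda>j k. \<Theta> k (x j))"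
proof -
  let ?p = "pochhammer (\<Sum>k=1..K. \<alpha> k) (card I)"
  have "0 < (\<Sum>k=1..K. \<alpha> k)" using K pos by (intro sum_pos) auto
  then have p: "?p \<noteq> 0" using pochhammer_pos[of "\<Sum>k=1..K. \<alpha> k" "card I"] by linarith
  have expand: "(\<Prod>j\<in>I. \<Sum>k=1..K. q k * \<Theta> k (x j)) =
      (\<Sum>z\<in>I \<rightarrow>\<^sub>E {1..K}. (\<Prod>j\<in>I. q (z j)) * (\<Prod>j\<in>I. \<Theta> (z j) (x j)))" for q :: "nat \<Rightarrow> real"
    using I by (simp add: prod_sum_PiE prod.distrib)
  have "has_bochner_integral (dirichlet K \<alpha>) (\<lambda>q. \<Prod>j\<in>I. \<Sum>k=1..K. q k * \<Theta> k (x j))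
      (\<Sum>z\<in>I \<rightarrow>\<^sub>E {1..K}. urn_weight {1..K} \<alpha> I z / ?p * (\<Prod>j\<in>I. \<Theta> (z j) (x j)))"
    unfolding expand
    by (intro has_bochner_integral_sum has_bochner_integral_mult_left
          dirichlet_assignment_moment[OF K pos I]) auto
  then have "lda_pmf K \<alpha> \<Theta> I x =
      (\<Sum>z\<in>I \<rightarrow>\<^sub>E {1..K}. urn_weight {1..K} \<alpha> I z / ?p * (\<Prod>j\<in>I. \<Theta> (z j) (x j)))"
    unfolding lda_pmf_def by (rule has_bochner_integral_integral_eq)
  then show ?thesis
    using p by (simp add: urn_sum_def sum_distrib_left)
qed

lemma mixture_pmf_eq_block_mass:
  assumes "\<And>k. k \<in> {1..K} \<Longrightarrow> \<alpha> k = A * \<alpha>' k"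
  shows "A * (fact (card S - 1) * mixture_pmf K \<alpha>' \<Theta> S x) =
         block_mass {1..K} \<alpha> S (\<lambda>j k. \<Theta> k (x j))"
  using assms by (simp add: block_mass_def topic_sum_def mixture_pmf_def sum_distrib_left mult_ac)

lemma card_partition_bounds:
  assumes "P \<in> partitions {1..N}" "1 \<le> N"
  shows "card P \<in> {1..N}"
proof -
  have P: "partition_on {1..N} P" using assms by (simp add: partitions_def)
  have finP: "finite P" using finite_elements[OF _ P] by simp
  have block: "finite S" "S \<noteq> {}" if "S \<in> P" for S
    using P that finite_subset[of S "{1..N}"] by (auto simp: partition_on_def)
  have "card P = (\<Sum>S\<in>P. 1)" by simp
  also have "\<dots> \<le> (\<Sum>S\<in>P. card S)"
    using block by (intro sum_mono) (simp add: Suc_le_eq card_gt_0_iff)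
  also have "\<dots> = N" using product_partition[OF P] block by simp
  finally have "card P \<le> N" .
  moreover have "P \<noteq> {}" using P assms(2) by (auto simp: partition_on_def)
  ultimately show ?thesis using finP by (simp add: Suc_le_eq card_gt_0_iff)
qed

lemma sum_set_partitions:
  fixes g :: "nat \<Rightarrow> nat set set \<Rightarrow> real"
  assumes "1 \<le> N"
  shows "(\<Sum>n=1..N. \<Sum>P\<in>set_partitions N n. g n P) = (\<Sum>P\<in>partitions {1..N}. g (card P) P)"
proof -
  have "finite (partitions {1..N})"
    unfolding partitions_def by (rule finitely_many_partition_on) simp
  moreover have "card ` partitions {1..N} \<subseteq> {1..N}"
    using card_partition_bounds[OF _ assms] by blast
  moreover have "set_partitions N n = {P \<in> partitions {1..N}. card P = n}" for n
    by (auto simp: set_partitions_def partitions_def)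
  ultimately show ?thesis
    using sum.group[of "partitions {1..N}" "{1..N}" card "\<lambda>P. g (card P) P"] by simp
qed

text \<open>
  The factor \<open>A\<^sup>n\<close> is absorbed into the block masses, one \<open>A\<close> per block, and \<open>A\<^bsup>[|S|]\<^esup>\<close> turns the LDA
  probability of a block into its urn sum; then the two partition formulas apply.
\<close>

theorem theorem1:
  fixes K N V :: nat
    and \<alpha> \<alpha>' :: "nat \<Rightarrow> real"
    and A :: real
    and \<Theta> :: "nat \<Rightarrow> nat \<Rightarrow> real"
    and x :: "nat \<Rightarrow> nat"
  assumes "K \<ge> 1" and "N \<ge> 1" and "V \<ge> 1"
    and "\<And>k. k \<in> {1..K} \<Longrightarrow> 0 < \<alpha> k"
    and "A = (\<Sum>k=1..K. \<alpha> k)"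
    and "\<alpha>' \<in> prob_simplex K"
    and "\<And>k. k \<in> {1..K} \<Longrightarrow> \<alpha> k = A * \<alpha>' k"
    and "\<And>k. k \<in> {1..K} \<Longrightarrow> \<Theta> k \<in> prob_simplex V"
    and "\<And>j. j \<in> {1..N} \<Longrightarrow> x j \<in> {1..V}"
  shows "lda_pmf K \<alpha> \<Theta> {1..N} x =
           1 / pochhammer A N *
           (\<Sum>n=1..N. A ^ n *
              (\<Sum>P\<in>set_partitions N n. \<Prod>S\<in>P. fact (card S - 1) * mixture_pmf K \<alpha>' \<Theta> S x))
         \<and>
         mixture_pmf K \<alpha>' \<Theta> {1..N} x =
           1 / (fact (N - 1) * A) *
           (\<Sum>n=1..N. (-1) ^ (n - 1) * fact (n - 1) *
              (\<Sum>P\<in>set_partitions N n. \<Prod>S\<in>P. pochhammer A (card S) * lda_pmf K \<alpha> \<Theta> S x))"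
proof -
  let ?f = "\<lambda>j k. \<Theta> k (x j)"
  let ?w = "\<lambda>n. (-1) ^ (n - 1) * fact (n - 1) :: real"
  have A_pos: "0 < A" unfolding assms(5) using assms(1,4) by (intro sum_pos) auto
  have lda: "pochhammer A (card S) * lda_pmf K \<alpha> \<Theta> S x = urn_sum {1..K} \<alpha> S ?f"
    if "finite S" for S
    unfolding assms(5) by (rule lda_pmf_eq_urn_sum[OF assms(1,4) that])
  have mixture: "A * (fact (card S - 1) * mixture_pmf K \<alpha>' \<Theta> S x) = block_mass {1..K} \<alpha> S ?f"
    for S by (rule mixture_pmf_eq_block_mass[OF assms(7)])
  have finite_block: "finite S" if "P \<in> partitions {1..N}" "S \<in> P" for P S
    using that finite_subset[of S "{1..N}"] by (auto simp: partitions_def partition_on_def)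

  have "pochhammer A N * lda_pmf K \<alpha> \<Theta> {1..N} x =
      partition_sum (\<lambda>_. 1) (block_mass {1..K} \<alpha>) {1..N} ?f"
    using lda[of "{1..N}"] urn_sum_eq_partition_sum[of "{1..K}" "{1..N}" \<alpha> ?f] by simp
  also have "\<dots> = (\<Sum>n=1..N. A ^ n *
      (\<Sum>P\<in>set_partitions N n. \<Prod>S\<in>P. fact (card S - 1) * mixture_pmf K \<alpha>' \<Theta> S x))"
    unfolding sum_distrib_left sum_set_partitions[OF assms(2)] partition_sum_def
      mixture[symmetric] prod.distrib[of "\<lambda>_. A"] prod_constant
    by simp
  finally have "pochhammer A N * lda_pmf K \<alpha> \<Theta> {1..N} x = \<dots>" .
  moreover have "pochhammer A N \<noteq> 0" using pochhammer_pos[OF A_pos, of N] by linarith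
  ultimately have first: "lda_pmf K \<alpha> \<Theta> {1..N} x = 1 / pochhammer A N *
      (\<Sum>n=1..N. A ^ n *
        (\<Sum>P\<in>set_partitions N n. \<Prod>S\<in>P. fact (card S - 1) * mixture_pmf K \<alpha>' \<Theta> S x))"
    by (simp add: field_simps)

  have "fact (N - 1) * A * mixture_pmf K \<alpha>' \<Theta> {1..N} x =
      partition_sum ?w (urn_sum {1..K} \<alpha>) {1..N} ?f"
    using mixture[of "{1..N}"] block_mass_eq_partition_sum[of "{1..K}" "{1..N}" \<alpha> ?f] assms(2)
    by (simp add: mult_ac)
  also have "\<dots> = (\<Sum>n=1..N. (-1) ^ (n - 1) * fact (n - 1) *
      (\<Sum>P\<in>set_partitions N n. \<Prod>S\<in>P. pochhammer A (card S) * lda_pmf K \<alpha> \<Theta> S x))"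
    unfolding sum_distrib_left sum_set_partitions[OF assms(2)] partition_sum_def
    using finite_block by (intro sum.cong refl arg_cong2[where f = "(*)"] prod.cong) (simp add: lda)
  finally have "fact (N - 1) * A * mixture_pmf K \<alpha>' \<Theta> {1..N} x = \<dots>" .
  then have second: "mixture_pmf K \<alpha>' \<Theta> {1..N} x = 1 / (fact (N - 1) * A) *
      (\<Sum>n=1..N. (-1) ^ (n - 1) * fact (n - 1) *
        (\<Sum>P\<in>set_partitions N n. \<Prod>S\<in>P. pochhammer A (card S) * lda_pmf K \<alpha> \<Theta> S x))"
    using A_pos by (simp add: field_simps)
  show ?thesis using first second by blast
qed

end
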